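(* Let $U$ be a vector space over $\mathbb{K}$ equipped with a self-duality, i.e. in duality with itself via a symmetric bilinear form $\langle\cdot,\cdot\rangle$. Let $\phi:\mathcal{T}(U)\to\mathcal{T}(U)$ be the linear map defined by $\phi(\mathbf{1})=\mathbf{1}$ and $\phi(x_1\otimes\cdots\otimes x_n)=x_1\,\square\,\cdots\,\square\, x_n$ for $x_1,\dots,x_n\in U$. Then for all $u,v\in\mathcal{T}(U)$, $$\phi(uv)=\phi(u)\,\square\,\phi(v),$$ where $uv$ is the ordinary product of $\mathcal{T}(U)$, i.e. $\phi$ is a homomorphism from the tensor algebra with its ordinary product to the tensor algebra with the square product. Moreover, $\phi$ is injective and surjective.
   Context: $\mathbb{K}$ is $\mathbb{R}$ or $\mathbb{C}$. $\mathcal{T}(U)=\bigoplus_{n\ge0}\bigotimes^nU$ is the tensor algebra with ordinary product $\otimes$ (concatenation) and unit $\mathbf{1}$, a Hopf algebra with co-multiplication $\Delta$ the algebra homomorphism determined by $\Delta(\mathbf{1})=\mathbf{1}\otimes\mathbf{1}$ and $\Delta(x)=\mathbf{1}\otimes x+x\otimes\mathbf{1}$ for $x\in U$; Sweedler notation: $\Delta(a)=\sum_{(a)}a_{(1)}\otimes a_{(2)}$. Laplace pairing on $\mathcal{T}(U)$: the unique symmetric bilinear form $(\cdot|\cdot)$ on $\mathcal{T}(U)$ with $(a|bc)=\sum_{(a)}(a_{(1)}|b)(a_{(2)}|c)$ for all $a,b,c$, $(\mathbf{1}|\mathbf{1})=1$, $(x|\mathbf{1})=(\mathbf{1}|x)=0$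 and $(x|y)=\langle x,y\rangle$ for $x,y\in U$. Square product on $\mathcal{T}(U)$: $a\,\square\, b=\sum_{(a),(b)}(a_{(1)}|b_{(1)})\,a_{(2)}\otimes b_{(2)}$, where $a_{(2)}\otimes b_{(2)}$ is the product in $\mathcal{T}(U)$. The square product is associative with unit $\mathbf{1}$, so iterated products need no parentheses. *)

theory Defs
  imports Complex_Main "HOL-Library.Poly_Mapping"
begin

text \<open>The ground field is a copy of the real or of the complex field.\<close>

definition real_or_complex :: "'k::field itself \<Rightarrow> bool" where
  "real_or_complex _ \<longleftrightarrow>
     (\<exists>f :: 'k \<Rightarrow> real. bij f \<and> (\<forall>x y. f (x + y) = f x + f y \<and> f (x * y) = f x * f y)) \<or>
     (\<exists>f :: 'k \<Rightarrow> complex. bij f \<and> (\<forall>x y. f (x + y) = f x + f y \<and> f (x * y) = f x * f y))"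


section \<open>Tensor products, tensor powers and the tensor algebra\<close>

text \<open>
  Tensor products are introduced as usual: the free vector space on the tuples (finitely supported
  functions), modulo the span of the multilinearity relations. The quotient depends on the scalar
  multiplication, so it is not a type; instead we say when a given space, together with a given
  formation of elementary tensors, is such a quotient.
\<close>

definition free_scale :: "'k::field \<Rightarrow> ('a \<Rightarrow>\<^sub>0 'k) \<Rightarrow> ('a \<Rightarrow>\<^sub>0 'k)" where
  "free_scale c p = Poly_Mapping.map ((*) c) p"

lemma lookup_free_scale: "Poly_Mapping.lookup (free_scale c p) a = c * Poly_Mapping.lookup p a"
  by (simp add: free_scale_def Poly_Mapping.map.rep_eq when_def)

lemma vector_space_free_scale: "vector_space (free_scale :: 'k::field \<Rightarrow> ('a \<Rightarrow>\<^sub>0 'k) \<Rightarrow> _)"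
  by unfold_locales
    (auto intro!: poly_mapping_eqI simp: lookup_free_scale lookup_add algebra_simps)

definition free_extend ::
    "('k::field \<Rightarrow> 'w::ab_group_add \<Rightarrow> 'w) \<Rightarrow> ('a \<Rightarrow> 'w) \<Rightarrow> ('a \<Rightarrow>\<^sub>0 'k) \<Rightarrow> 'w" where
  "free_extend s f p = (\<Sum>a\<in>Poly_Mapping.keys p. s (Poly_Mapping.lookup p a) (f a))"

text \<open>
  The linear extension of \<open>f\<close> induces an isomorphism from the free vector space on \<open>A\<close> modulo the
  span of the relations \<open>N\<close> onto the linear span of \<open>f ` A\<close>.
\<close>

definition presented_by ::
    "('k::field \<Rightarrow> 'w::ab_group_add \<Rightarrow> 'w) \<Rightarrow> ('a \<Rightarrow> 'w) \<Rightarrow> 'a set \<Rightarrow> ('a \<Rightarrow>\<^sub>0 'k) set \<Rightarrow> bool" where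
  "presented_by s f A N \<longleftrightarrow>
     (\<forall>p. Poly_Mapping.keys p \<subseteq> A \<longrightarrow> (free_extend s f p = 0 \<longleftrightarrow> p \<in> module.span free_scale N))"

definition bilinear_rels ::
    "('k::field \<Rightarrow> 'a::ab_group_add \<Rightarrow> 'a) \<Rightarrow> ('k \<Rightarrow> 'b::ab_group_add \<Rightarrow> 'b) \<Rightarrow> ('a \<times> 'b \<Rightarrow>\<^sub>0 'k) set" where
  "bilinear_rels s1 s2 =
     {Poly_Mapping.single (a + a', b) 1 - Poly_Mapping.single (a, b) 1
        - Poly_Mapping.single (a', b) 1 | a a' b. True} \<union>
     {Poly_Mapping.single (a, b + b') 1 - Poly_Mapping.single (a, b) 1
        - Poly_Mapping.single (a, b') 1 | a b b'. True} \<union>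
     {Poly_Mapping.single (s1 c a, b) 1 - Poly_Mapping.single (a, b) c | c a b. True} \<union>
     {Poly_Mapping.single (a, s2 c b) 1 - Poly_Mapping.single (a, b) c | c a b. True}"

definition multilinear_rels ::
    "('k::field \<Rightarrow> 'u::ab_group_add \<Rightarrow> 'u) \<Rightarrow> nat \<Rightarrow> ('u list \<Rightarrow>\<^sub>0 'k) set" where
  "multilinear_rels s n =
     {Poly_Mapping.single (v @ [x + y] @ w) 1 - Poly_Mapping.single (v @ [x] @ w) 1
        - Poly_Mapping.single (v @ [y] @ w) 1 | v x y w. length (v @ [x] @ w) = n} \<union>
     {Poly_Mapping.single (v @ [s c x] @ w) 1 - Poly_Mapping.single (v @ [x] @ w) c
        | v c x w. length (v @ [x] @ w) = n}"

locale unital_algebra = vector_space scale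
  for scale :: "'k::field \<Rightarrow> 'a::ring_1 \<Rightarrow> 'a" +
  assumes scale_mult_left: "scale c a * b = scale c (a * b)"
    and scale_mult_right: "a * scale c b = scale c (a * b)"

text \<open>
  The tensor algebra of the vector space \<open>(U, sU)\<close>. Its product \<open>*\<close> is concatenation of tensors:
  the elementary tensor of \<open>x1, ..., xn\<close> is the product of the \<open>\<iota> xi\<close>, the space \<open>degree n\<close> of
  linear combinations of such tensors is the \<open>n\<close>-th tensor power of \<open>U\<close>, and the whole algebra is
  the direct sum of these spaces.
\<close>

locale tensor_algebra = U: vector_space sU + T: unital_algebra sT
  for sU :: "'k::field \<Rightarrow> 'u::ab_group_add \<Rightarrow> 'u"
    and sT :: "'k \<Rightarrow> 't::ring_1 \<Rightarrow> 't" +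
  fixes \<iota> :: "'u \<Rightarrow> 't"
begin

definition tensor :: "'u list \<Rightarrow> 't" where
  "tensor xs = prod_list (map \<iota> xs)"

definition degree :: "nat \<Rightarrow> 't set" where
  "degree n = T.span (tensor ` {xs. length xs = n})"

end

locale is_tensor_algebra = tensor_algebra sU sT \<iota>
  for sU :: "'k::field \<Rightarrow> 'u::ab_group_add \<Rightarrow> 'u"
    and sT :: "'k \<Rightarrow> 't::ring_1 \<Rightarrow> 't"
    and \<iota> :: "'u \<Rightarrow> 't" +
  assumes tensor_power: "\<And>n. presented_by sT tensor {xs. length xs = n} (multilinear_rels sU n)"
    and direct_sum: "\<And>t. \<exists>!c. (\<forall>n. c n \<in> degree n) \<and> finite {n. c n \<noteq> 0} \<and>
                       t = (\<Sum>n | c n \<noteq> 0. c n)"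

text \<open>
  The tensor product of an algebra with itself (\<open>pure a b\<close> being the elementary tensor of \<open>a\<close>
  and \<open>b\<close>), with its usual algebra structure.
\<close>

locale is_tensor_square = A: unital_algebra sA + W: unital_algebra sW
  for sA :: "'k::field \<Rightarrow> 'a::ring_1 \<Rightarrow> 'a"
    and sW :: "'k \<Rightarrow> 'w::ring_1 \<Rightarrow> 'w" +
  fixes pure :: "'a \<Rightarrow> 'a \<Rightarrow> 'w"
  assumes pure_span: "W.span (case_prod pure ` UNIV) = UNIV"
    and pure_presented: "presented_by sW (case_prod pure) UNIV (bilinear_rels sA sA)"
    and pure_mult: "pure a b * pure c d = pure (a * c) (b * d)"
    and pure_one: "pure 1 1 = 1"


section \<open>Laplace pairing and square product\<close>

definition symmetric_bilinear_form ::
    "('k::field \<Rightarrow> 'v::ab_group_add \<Rightarrow> 'v) \<Rightarrow> ('v \<Rightarrow> 'v \<Rightarrow> 'k) \<Rightarrow> bool" where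
  "symmetric_bilinear_form s B \<longleftrightarrow>
     (\<forall>x. Vector_Spaces.linear s (*) (B x)) \<and>
     (\<forall>y. Vector_Spaces.linear s (*) (\<lambda>x. B x y)) \<and>
     (\<forall>x y. B x y = B y x)"

text \<open>\<open>iterate_prod f x [y1, ..., yn]\<close> is \<open>f x (f y1 (... yn))\<close>.\<close>

primrec iterate_prod :: "('a \<Rightarrow> 'a \<Rightarrow> 'a) \<Rightarrow> 'a \<Rightarrow> 'a list \<Rightarrow> 'a" where
  "iterate_prod f x [] = x"
| "iterate_prod f x (y # ys) = f x (iterate_prod f y ys)"

locale self_dual_tensor_algebra =
  is_tensor_algebra sU sT \<iota> + is_tensor_square sT sW pure
  for sU :: "'k::field \<Rightarrow> 'u::ab_group_add \<Rightarrow> 'u"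
    and sT :: "'k \<Rightarrow> 't::ring_1 \<Rightarrow> 't"
    and \<iota> :: "'u \<Rightarrow> 't"
    and sW :: "'k \<Rightarrow> 'w::ring_1 \<Rightarrow> 'w"
    and pure :: "'t \<Rightarrow> 't \<Rightarrow> 'w" +
  fixes form :: "'u \<Rightarrow> 'u \<Rightarrow> 'k"
  assumes form: "symmetric_bilinear_form sU form"
begin

definition comult :: "'t \<Rightarrow> 'w" where
  "comult = (THE D. Vector_Spaces.linear sT sW D \<and> D 1 = pure 1 1 \<and>
     (\<forall>a b. D (a * b) = D a * D b) \<and> (\<forall>x. D (\<iota> x) = pure 1 (\<iota> x) + pure (\<iota> x) 1))"

text \<open>
  Sweedler notation: a finite family of pairs \<open>(a1, a2)\<close> with \<open>comult a\<close> the sum of the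
  \<open>pure a1 a2\<close>. It is only used in expressions bilinear in \<open>(a1, a2)\<close>, whose sum does not depend
  on the family chosen.
\<close>

definition sweedler :: "'t \<Rightarrow> ('t \<times> 't) list" where
  "sweedler a = (SOME ps. comult a = (\<Sum>(a1, a2)\<leftarrow>ps. pure a1 a2))"

definition laplace :: "'t \<Rightarrow> 't \<Rightarrow> 'k" where
  "laplace = (THE P. symmetric_bilinear_form sT P \<and>
     (\<forall>a b c. P a (b * c) = (\<Sum>(a1, a2)\<leftarrow>sweedler a. P a1 b * P a2 c)) \<and>
     P 1 1 = 1 \<and> (\<forall>x. P (\<iota> x) 1 = 0 \<and> P 1 (\<iota> x) = 0) \<and>
     (\<forall>x y. P (\<iota> x) (\<iota> y) = form x y))"

definition square :: "'t \<Rightarrow> 't \<Rightarrow> 't" where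
  "square a b =
     (\<Sum>(a1, a2)\<leftarrow>sweedler a. \<Sum>(b1, b2)\<leftarrow>sweedler b. sT (laplace a1 b1) (a2 * b2))"

definition phi :: "'t \<Rightarrow> 't" where
  "phi = (THE f. Vector_Spaces.linear sT sT f \<and> f 1 = 1 \<and>
     (\<forall>x xs. f (tensor (x # xs)) = iterate_prod square (\<iota> x) (map \<iota> xs)))"

end

end

theory Submission
  imports Defs
begin

text \<open>
  For a vector \<open>x\<close> let \<open>D x\<close> be the contraction with \<open>x\<close>: the derivation of the tensor algebra with
  \<open>D x (\<iota> y) = \<langle>x, y\<rangle>\<close>. Everything in the theorem is expressed through these operators.

  Contractions commute, because a commutator of derivations is a derivation and this one vanishes on
  generators. Hence \<open>x \<mapsto> D x\<close> extends to an action of the tensor algebra on itself, and the Laplace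
  pairing of \<open>a\<close> and \<open>b\<close> is the counit of \<open>a\<close> acting on \<open>b\<close>; the Laplace identity is the Leibniz rule
  for this action, written with the comultiplication. For the square product this gives
  \<open>x \<box> b = \<iota> x * b + D x b\<close> (\<open>square_vector\<close>) and shows that \<open>D x\<close> is also a derivation for \<open>\<box>\<close>
  (\<open>contract_square\<close>). The two facts together yield associativity when the first factor is a vector,
  \<open>x \<box> (a \<box> b) = (x \<box> a) \<box> b\<close> (\<open>square_assoc_vector\<close>). Since
  \<open>\<phi> (\<iota> x * u) = x \<box> \<phi> u\<close>, multiplicativity of \<open>\<phi>\<close> follows by induction on the first factor.

  For bijectivity, \<open>\<phi>\<close> is the member \<open>\<phi> 1\<close> of a one-parameter family of linear maps \<open>\<phi> c\<close> given by
  \<open>\<phi> c (\<iota> x * a) = \<iota> x * \<phi> c a + c D x (\<phi> c a)\<close>. Each of them commutes with all contractions, so in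
  \<open>\<phi> (- c) (\<phi> c (\<iota> x * a))\<close> the two contraction terms cancel and \<open>\<phi> (- c)\<close> inverts \<open>\<phi> c\<close>
  (\<open>wick_inverse\<close>).

  Identities involving the comultiplication are handled as follows: for a bilinear \<open>F\<close> the Sweedler
  sum of \<open>F\<close> over \<open>\<iota> x * a\<close> is the one of \<open>F (\<iota> x * p) q + F p (\<iota> x * q)\<close> over \<open>a\<close>
  (\<open>sweedler_sum_step\<close>), so they are proved by induction on \<open>a\<close> for all \<open>F\<close> at once.
\<close>

section \<open>Linear maps out of a presented space\<close>

lemma linear_by_equations:
  assumes "vector_space s" "vector_space s'"
    and "\<And>x y. f (x + y) = f x + f y" "\<And>c x. f (s c x) = s' c (f x)"
  shows "Vector_Spaces.linear s s' f"
proof -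
  interpret vector_space_pair s s'
    using assms(1,2) by (simp add: vector_space_pair_def)
  show ?thesis
    using assms(3,4) by unfold_locales auto
qed

lemma vector_space_field: "vector_space ((*) :: 'k::field \<Rightarrow> 'k \<Rightarrow> 'k)"
  by unfold_locales (simp_all add: algebra_simps)

lemma free_extend_on_superset:
  assumes "vector_space s" "finite S" "Poly_Mapping.keys p \<subseteq> S"
  shows "free_extend s f p = (\<Sum>a\<in>S. s (Poly_Mapping.lookup p a) (f a))"
proof -
  interpret vector_space s by fact
  show ?thesis
    unfolding free_extend_def using assms(2,3)
    by (intro sum.mono_neutral_left) (auto simp: in_keys_iff)
qed

lemma free_extend_linear:
  fixes s :: "'k::field \<Rightarrow> 'w::ab_group_add \<Rightarrow> 'w" and f :: "'a \<Rightarrow> 'w"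
  assumes "vector_space s"
  shows "Vector_Spaces.linear free_scale s (free_extend s f)"
proof -
  interpret vector_space s by fact
  show ?thesis
  proof (rule linear_by_equations[OF vector_space_free_scale assms])
    fix p q :: "'a \<Rightarrow>\<^sub>0 'k"
    let ?S = "Poly_Mapping.keys p \<union> Poly_Mapping.keys q"
    have "Poly_Mapping.keys (p + q) \<subseteq> ?S" by (rule keys_add)
    then show "free_extend s f (p + q) = free_extend s f p + free_extend s f q"
      by (simp add: free_extend_on_superset[OF assms, of ?S] lookup_add scale_left_distrib
          sum.distrib)
  next
    fix c and p :: "'a \<Rightarrow>\<^sub>0 'k"
    have "Poly_Mapping.keys (free_scale c p) \<subseteq> Poly_Mapping.keys p"
      by (auto simp: in_keys_iff lookup_free_scale)
    then show "free_extend s f (free_scale c p) = s c (free_extend s f p)"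
      by (simp add: free_extend_on_superset[OF assms, of "Poly_Mapping.keys p"]
          lookup_free_scale scale_sum_right)
  qed
qed

lemma free_extend_single:
  assumes "vector_space s"
  shows "free_extend s f (Poly_Mapping.single a c) = s c (f a)"
  using free_extend_on_superset[OF assms, of "{a}" "Poly_Mapping.single a c" f] by simp

text \<open>
  This is the universal property of the quotient. Since the quotient is not given as a type of
  classes, the map is built on a basis of the span consisting of generators. Any other generator is
  a combination of basis elements, and the difference of the two sides is a relation, hence killed
  by \<open>g\<close>.
\<close>

lemma presented_by_extend:
  assumes V: "vector_space s" and V': "vector_space s'"
    and pres: "presented_by s f A N"
    and kills: "\<And>p. p \<in> N \<Longrightarrow> free_extend s' g p = 0"
  shows "\<exists>h. Vector_Spaces.linear s s' h \<and> (\<forall>a\<in>A. h (f a) = g a)"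
proof -
  interpret V: vector_space s by fact
  interpret V': vector_space s' by fact
  interpret V: vector_space_pair s s' ..
  interpret F: vector_space free_scale by (rule vector_space_free_scale)
  interpret ef: Vector_Spaces.linear free_scale s "free_extend s f"
    by (rule free_extend_linear[OF V])
  interpret eg: Vector_Spaces.linear free_scale s' "free_extend s' g"
    by (rule free_extend_linear[OF V'])
  obtain B where B: "B \<subseteq> f ` A" "V.independent B" "f ` A \<subseteq> V.span B"
    using V.maximal_independent_subset by blast
  have "\<forall>b\<in>B. \<exists>a. a \<in> A \<and> f a = b"
    using B(1) by blast
  then obtain r where r: "\<And>b. b \<in> B \<Longrightarrow> r b \<in> A \<and> f (r b) = b"
    by metis
  obtain h where h: "Vector_Spaces.linear s s' h" "\<And>b. b \<in> B \<Longrightarrow> h b = g (r b)"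
    using V.linear_independent_extend[OF B(2), of "\<lambda>b. g (r b)"] by blast
  interpret h: Vector_Spaces.linear s s' h by (rule h(1))
  have lift: "\<exists>p. Poly_Mapping.keys p \<subseteq> A \<and> free_extend s f p = v \<and> free_extend s' g p = h v"
    if "v \<in> V.span B" for v
    using that
  proof (induction rule: V.span_induct_alt)
    case base
    show ?case by (rule exI[of _ 0]) (simp add: ef.zero eg.zero h.zero)
  next
    case (step c b v)
    then obtain p where p: "Poly_Mapping.keys p \<subseteq> A" "free_extend s f p = v"
      "free_extend s' g p = h v" by blast
    have "Poly_Mapping.keys (Poly_Mapping.single (r b) c + p) \<subseteq> A"
      using keys_add[of "Poly_Mapping.single (r b) c" p] p(1) r[OF step(1)]
      by (auto split: if_splits)
    then show ?case
      using p r[OF step(1)] h(2)[OF step(1)]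
      by (intro exI[of _ "Poly_Mapping.single (r b) c + p"])
         (simp add: ef.add eg.add h.add h.scale free_extend_single V V')
  qed
  have zero_on_span: "free_extend s' g p = 0" if "p \<in> F.span N" for p
    using that
    by (induction rule: F.span_induct_alt) (auto simp: eg.zero eg.add eg.scale kills)
  have "h (f a) = g a" if a: "a \<in> A" for a
  proof -
    obtain p where p: "Poly_Mapping.keys p \<subseteq> A" "free_extend s f p = f a"
      "free_extend s' g p = h (f a)"
      using lift[of "f a"] B(3) a by blast
    let ?q = "p - Poly_Mapping.single a 1"
    have "Poly_Mapping.keys ?q \<subseteq> A"
      using keys_diff[of p "Poly_Mapping.single a 1"] p(1) a by (auto split: if_splits)
    moreover have "free_extend s f ?q = 0"
      by (simp add: ef.diff p(2) free_extend_single V)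
    ultimately have "?q \<in> F.span N"
      using pres by (simp add: presented_by_def)
    then have "free_extend s' g ?q = 0" by (rule zero_on_span)
    then show ?thesis by (simp add: eg.diff p(3) free_extend_single V')
  qed
  with h(1) show ?thesis by blast
qed

section \<open>Recursion over the tensor algebra\<close>

context is_tensor_algebra
begin

lemma tensor_Nil [simp]: "tensor [] = 1"
  and tensor_Cons [simp]: "tensor (x # xs) = \<iota> x * tensor xs"
  by (simp_all add: tensor_def)

lemma span_tensor: "T.span (range tensor) = UNIV"
proof -
  have "t \<in> T.span (range tensor)" for t
  proof -
    obtain c where c: "\<forall>n. c n \<in> degree n" "t = (\<Sum>n | c n \<noteq> 0. c n)"
      using direct_sum[of t] by blast
    have "degree n \<subseteq> T.span (range tensor)" for n
      unfolding degree_def by (rule T.span_mono) auto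
    with c show ?thesis by (auto intro: T.span_sum)
  qed
  then show ?thesis by auto
qed

lemma tensor_algebra_induct [case_names one mult add scale]:
  assumes "P 1" "\<And>x a. P a \<Longrightarrow> P (\<iota> x * a)"
    and "\<And>a b. P a \<Longrightarrow> P b \<Longrightarrow> P (a + b)" "\<And>c a. P a \<Longrightarrow> P (sT c a)"
  shows "P a"
proof -
  have tens: "P (tensor xs)" for xs
    by (induction xs) (simp_all add: assms)
  have "a \<in> T.span (range tensor)" by (simp add: span_tensor)
  then show ?thesis
  proof (induction rule: T.span_induct_alt)
    case base
    show ?case using assms(4)[OF assms(1), of 0] by simp
  next
    case (step c x y)
    then show ?case using assms(3,4) tens by blast
  qed
qed

lemma multilinear_rels_keys:
  "p \<in> multilinear_rels sU n \<Longrightarrow> Poly_Mapping.keys p \<subseteq> {xs. length xs = n}"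
  unfolding multilinear_rels_def
  by (auto dest!: set_mp[OF keys_diff] split: if_splits)

lemma tensor_kills_rels:
  assumes "p \<in> multilinear_rels sU n"
  shows "free_extend sT tensor p = 0"
proof -
  interpret F: vector_space "free_scale :: 'k \<Rightarrow> ('u list \<Rightarrow>\<^sub>0 'k) \<Rightarrow> _"
    by (rule vector_space_free_scale)
  show ?thesis
    using tensor_power[of n] multilinear_rels_keys[OF assms] F.span_base[OF assms]
    by (auto simp: presented_by_def)
qed

lemma iota_add: "\<iota> (x + y) = \<iota> x + \<iota> y"
  and iota_scale: "\<iota> (sU c x) = sT c (\<iota> x)"
proof -
  interpret e: Vector_Spaces.linear free_scale sT "free_extend sT tensor"
    by (rule free_extend_linear) (rule T.vector_space_axioms)
  let ?single = "Poly_Mapping.single :: _ \<Rightarrow> 'k \<Rightarrow> _"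
  have "?single ([] @ [x + y] @ []) 1 - ?single ([] @ [x] @ []) 1 - ?single ([] @ [y] @ []) 1
      \<in> multilinear_rels sU 1"
    unfolding multilinear_rels_def by fastforce
  from tensor_kills_rels[OF this] show "\<iota> (x + y) = \<iota> x + \<iota> y"
    by (simp add: e.diff e.add free_extend_single T.vector_space_axioms algebra_simps)
  have "?single ([] @ [sU c x] @ []) 1 - ?single ([] @ [x] @ []) c \<in> multilinear_rels sU 1"
    unfolding multilinear_rels_def by fastforce
  from tensor_kills_rels[OF this] show "\<iota> (sU c x) = sT c (\<iota> x)"
    by (simp add: e.diff free_extend_single T.vector_space_axioms algebra_simps)
qed

text \<open>
  The tensor powers are presented one degree at a time. The directness of the sum glues these
  presentations: a combination of elementary tensors that vanishes has vanishing homogeneous parts,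
  and each part lies in the span of the relations of its degree.
\<close>

lemma tensor_presented: "presented_by sT tensor UNIV (\<Union>n. multilinear_rels sU n)"
proof -
  interpret F: vector_space "free_scale :: 'k \<Rightarrow> ('u list \<Rightarrow>\<^sub>0 'k) \<Rightarrow> _"
    by (rule vector_space_free_scale)
  interpret e: Vector_Spaces.linear free_scale sT "free_extend sT tensor"
    by (rule free_extend_linear) (rule T.vector_space_axioms)
  have "free_extend sT tensor p = 0 \<longleftrightarrow> p \<in> F.span (\<Union>n. multilinear_rels sU n)" for p
  proof
    assume "p \<in> F.span (\<Union>n. multilinear_rels sU n)"
    then show "free_extend sT tensor p = 0"
      by (induction rule: F.span_induct_alt)
         (auto simp: e.zero e.add e.scale tensor_kills_rels)
  next
    assume zero: "free_extend sT tensor p = 0"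
    define part where "part n = (\<Sum>xs | xs \<in> Poly_Mapping.keys p \<and> length xs = n.
        Poly_Mapping.single xs (Poly_Mapping.lookup p xs))" for n
    let ?I = "length ` Poly_Mapping.keys p"
    have "p = (\<Sum>xs\<in>Poly_Mapping.keys p. Poly_Mapping.single xs (Poly_Mapping.lookup p xs))"
      by (rule poly_mapping_eqI)
         (auto simp: lookup_sum lookup_single when_def in_keys_iff)
    also have "\<dots> = (\<Sum>n\<in>?I. part n)"
      unfolding part_def by (rule sum.image_gen) simp
    finally have p: "p = (\<Sum>n\<in>?I. part n)" .
    have keys: "Poly_Mapping.keys (part n) \<subseteq> {xs. length xs = n}" for n
      unfolding part_def by (rule order_trans[OF keys_sum]) (auto split: if_splits)
    let ?c = "\<lambda>n. free_extend sT tensor (part n)"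
    have c_deg: "?c n \<in> degree n" for n
      unfolding degree_def free_extend_def using keys[of n]
      by (intro T.span_sum T.span_scale T.span_base) auto
    have c_supp: "{n. ?c n \<noteq> 0} \<subseteq> ?I"
    proof (clarify, rule ccontr)
      fix n assume "?c n \<noteq> 0" "n \<notin> ?I"
      then have "{xs. xs \<in> Poly_Mapping.keys p \<and> length xs = n} = {}" by auto
      then have "part n = 0" by (simp only: part_def sum.empty)
      with \<open>?c n \<noteq> 0\<close> show False by (simp add: e.zero)
    qed
    have "0 = (\<Sum>n\<in>?I. ?c n)"
      using zero by (subst (asm) p) (simp add: e.sum)
    also have "\<dots> = (\<Sum>n | ?c n \<noteq> 0. ?c n)"
      by (rule sum.mono_neutral_right) (use c_supp in auto)
    finally have "0 = (\<Sum>n | ?c n \<noteq> 0. ?c n)" .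
    moreover have "finite {n. ?c n \<noteq> 0}"
      by (rule finite_subset[OF c_supp]) simp
    moreover have "\<forall>n. 0 \<in> degree n" by (simp add: degree_def T.span_zero)
    moreover obtain c where "\<And>d. (\<forall>n. d n \<in> degree n) \<and> finite {n. d n \<noteq> 0} \<and>
        0 = (\<Sum>n | d n \<noteq> 0. d n) \<Longrightarrow> d = c"
      using direct_sum[of 0] by (elim ex1E) blast
    ultimately have "?c = c" "(\<lambda>_. 0) = c"
      using c_deg by simp_all
    then have "?c = (\<lambda>_. 0)" by simp
    then have "part n \<in> F.span (multilinear_rels sU n)" for n
      using tensor_power[of n] keys[of n] by (auto simp: presented_by_def dest: fun_cong)
    then have "part n \<in> F.span (\<Union>n. multilinear_rels sU n)" for n
      using F.span_mono[of "multilinear_rels sU n" "\<Union>n. multilinear_rels sU n"] by blast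
    then show "p \<in> F.span (\<Union>n. multilinear_rels sU n)"
      by (subst p) (rule F.span_sum)
  qed
  then show ?thesis by (simp add: presented_by_def)
qed

text \<open>
  A step \<open>L\<close> describes a map on \<open>\<iota> x * a\<close> in terms of \<open>x\<close>, \<open>a\<close> and the value \<open>v\<close> at \<open>a\<close>, as in
  primitive recursion. The condition is linearity in \<open>x\<close> and joint linearity in the pair \<open>(a, v)\<close>;
  linearity in \<open>a\<close> and \<open>v\<close> separately would exclude the defining step of a derivation, which is a sum
  of a term in \<open>a\<close> and a term in \<open>v\<close>.
\<close>

definition linear_step :: "('k \<Rightarrow> 'v::ab_group_add \<Rightarrow> 'v) \<Rightarrow> ('u \<Rightarrow> 't \<Rightarrow> 'v \<Rightarrow> 'v) \<Rightarrow> bool" where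
  "linear_step sV L \<longleftrightarrow> vector_space sV \<and>
     (\<forall>x y a v. L (x + y) a v = L x a v + L y a v) \<and>
     (\<forall>c x a v. L (sU c x) a v = sV c (L x a v)) \<and>
     (\<forall>x a b v w. L x (a + b) (v + w) = L x a v + L x b w) \<and>
     (\<forall>c x a v. L x (sT c a) (sV c v) = sV c (L x a v))"

text \<open>
  Recursion on the list of factors of an elementary tensor is multilinear in the factors when the
  step is linear, so it descends to the tensor algebra. Algebra homomorphisms, derivations and
  module structures out of the tensor algebra are all obtained in this way.
\<close>

lemma tensor_recursion:
  assumes L: "linear_step sV L"
  shows "\<exists>h. Vector_Spaces.linear sT sV h \<and> h 1 = v0 \<and> (\<forall>x a. h (\<iota> x * a) = L x a (h a))"
proof -
  interpret V: vector_space sV using L by (simp add: linear_step_def)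
  have L_eqs: "L (x + y) a v = L x a v + L y a v" "L (sU c x) a v = sV c (L x a v)"
    "L x (a + b) (v + w) = L x a v + L x b w" "L x (sT c a) (sV c v) = sV c (L x a v)"
    for x y a b c v w
    using L unfolding linear_step_def by blast+
  define F where "F = rec_list v0 (\<lambda>x xs v. L x (tensor xs) v)"
  have F_simps: "F [] = v0" "F (x # xs) = L x (tensor xs) (F xs)" for x xs
    by (simp_all add: F_def)
  have T_add: "tensor (v @ (x + y) # w) = tensor (v @ x # w) + tensor (v @ y # w)" for v x y w
    by (induction v) (simp_all add: iota_add algebra_simps)
  have T_scale: "tensor (v @ sU c x # w) = sT c (tensor (v @ x # w))" for v c x w
    by (induction v) (simp_all add: iota_scale T.scale_mult_left T.scale_mult_right)
  have F_add: "F (v @ (x + y) # w) = F (v @ x # w) + F (v @ y # w)" for v x y w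
    by (induction v) (simp_all add: F_simps L_eqs T_add)
  have F_scale: "F (v @ sU c x # w) = sV c (F (v @ x # w))" for v c x w
    by (induction v) (simp_all add: F_simps L_eqs T_scale)
  interpret e: Vector_Spaces.linear free_scale sV "free_extend sV F"
    by (rule free_extend_linear) (rule V.vector_space_axioms)
  have "free_extend sV F p = 0" if "p \<in> (\<Union>n. multilinear_rels sU n)" for p
    using that unfolding multilinear_rels_def
    by (auto simp: e.diff free_extend_single V.vector_space_axioms F_add F_scale)
  from presented_by_extend[OF T.vector_space_axioms V.vector_space_axioms tensor_presented this]
  obtain h where h: "Vector_Spaces.linear sT sV h" "\<And>xs. h (tensor xs) = F xs" by auto
  interpret h: Vector_Spaces.linear sT sV h by (rule h(1))
  have h_step: "h (\<iota> x * a) = L x a (h a)" for x a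
  proof -
    have L_zero: "L x 0 0 = 0" using L_eqs(4)[of x 0 0 0] by simp
    have "a \<in> T.span (range tensor)" by (simp add: span_tensor)
    then show ?thesis
    proof (induction rule: T.span_induct_alt)
      case base
      show ?case by (simp add: h.zero L_zero)
    next
      case (step c b a)
      from step(1) obtain xs where "b = tensor xs" by auto
      then have "h (\<iota> x * b) = L x b (h b)"
        using h(2)[of "x # xs"] h(2)[of xs] by (simp add: F_simps)
      with step(2) show ?case
        by (simp add: distrib_left T.scale_mult_right h.add h.scale L_eqs)
    qed
  qed
  show ?thesis
    using h(1) h(2)[of "[]"] h_step by (intro exI[of _ h]) (simp add: F_simps)
qed

definition tensor_rec ::
    "('k \<Rightarrow> 'v::ab_group_add \<Rightarrow> 'v) \<Rightarrow> 'v \<Rightarrow> ('u \<Rightarrow> 't \<Rightarrow> 'v \<Rightarrow> 'v) \<Rightarrow> 't \<Rightarrow> 'v" where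
  "tensor_rec sV v0 L = (SOME h. Vector_Spaces.linear sT sV h \<and> h 1 = v0 \<and>
     (\<forall>x a. h (\<iota> x * a) = L x a (h a)))"

lemma tensor_rec:
  assumes "linear_step sV L"
  shows "Vector_Spaces.linear sT sV (tensor_rec sV v0 L)"
    and "tensor_rec sV v0 L 1 = v0"
    and "tensor_rec sV v0 L (\<iota> x * a) = L x a (tensor_rec sV v0 L a)"
  using someI_ex[OF tensor_recursion[OF assms, of v0], folded tensor_rec_def] by auto

end

section \<open>Bilinear maps and the tensor square\<close>

definition bilinear_map ::
    "('k::field \<Rightarrow> 'a::ab_group_add \<Rightarrow> 'a) \<Rightarrow> ('k \<Rightarrow> 'v::ab_group_add \<Rightarrow> 'v) \<Rightarrow> ('a \<Rightarrow> 'a \<Rightarrow> 'v) \<Rightarrow> bool"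
  where
  "bilinear_map s s' F \<longleftrightarrow> vector_space s' \<and>
     (\<forall>a a' b. F (a + a') b = F a b + F a' b) \<and> (\<forall>c a b. F (s c a) b = s' c (F a b)) \<and>
     (\<forall>a b b'. F a (b + b') = F a b + F a b') \<and> (\<forall>c a b. F a (s c b) = s' c (F a b))"

lemma bilinear_mapD:
  assumes "bilinear_map s s' F"
  shows "vector_space s'"
    and "F (a + a') b = F a b + F a' b" "F (s c a) b = s' c (F a b)"
    and "F a (b + b') = F a b + F a b'" "F a (s c b) = s' c (F a b)"
  using assms unfolding bilinear_map_def by blast+

context is_tensor_square
begin

lemma bilinear_rels_killed:
  assumes "bilinear_map sA s F" "p \<in> bilinear_rels sA sA"
  shows "free_extend s (case_prod F) p = 0"
proof -
  note F = bilinear_mapD[OF assms(1)]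
  interpret V: vector_space s by (rule F)
  interpret e: Vector_Spaces.linear free_scale s "free_extend s (case_prod F)"
    by (rule free_extend_linear) (rule F)
  show ?thesis
    using assms(2) unfolding bilinear_rels_def
    by (auto simp: e.diff free_extend_single F)
qed

lemma pure_bilinear: "bilinear_map sA sW pure"
proof -
  interpret F: vector_space "free_scale :: 'k \<Rightarrow> ('a \<times> 'a \<Rightarrow>\<^sub>0 'k) \<Rightarrow> _"
    by (rule vector_space_free_scale)
  interpret e: Vector_Spaces.linear free_scale sW "free_extend sW (case_prod pure)"
    by (rule free_extend_linear) (rule W.vector_space_axioms)
  let ?single = "Poly_Mapping.single :: _ \<Rightarrow> 'k \<Rightarrow> _"
  have killed: "free_extend sW (case_prod pure) p = 0" if "p \<in> bilinear_rels sA sA" for p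
    using pure_presented F.span_base[OF that] by (simp add: presented_by_def)
  have rels:
    "?single (a + a', b) 1 - ?single (a, b) 1 - ?single (a', b) 1 \<in> bilinear_rels sA sA"
    "?single (a, b + b') 1 - ?single (a, b) 1 - ?single (a, b') 1 \<in> bilinear_rels sA sA"
    "?single (sA c a, b) 1 - ?single (a, b) c \<in> bilinear_rels sA sA"
    "?single (a, sA c b) 1 - ?single (a, b) c \<in> bilinear_rels sA sA" for a a' b b' c
    unfolding bilinear_rels_def by blast+
  show ?thesis
    unfolding bilinear_map_def
    using rels[THEN killed]
    by (simp add: e.diff e.add free_extend_single W.vector_space_axioms diff_diff_eq)
qed

lemma bilinear_extend:
  assumes "bilinear_map sA s F"
  shows "\<exists>h. Vector_Spaces.linear sW s h \<and> (\<forall>a b. h (pure a b) = F a b)"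
  using presented_by_extend[OF W.vector_space_axioms bilinear_mapD(1)[OF assms] pure_presented
      bilinear_rels_killed[OF assms]]
  by auto

text \<open>
  This guarantees that the choice in the definition of Sweedler notation is made from a nonempty set.
\<close>

lemma pure_decomposition: "\<exists>ps. w = (\<Sum>(a, b)\<leftarrow>ps. pure a b)"
proof -
  note pure_eqs = bilinear_mapD[OF pure_bilinear]
  have "w \<in> W.span (case_prod pure ` UNIV)" by (simp add: pure_span)
  then show ?thesis
  proof (induction rule: W.span_induct_alt)
    case base
    show ?case by (rule exI[of _ "[]"]) simp
  next
    case (step c x y)
    then obtain a b ps where "x = pure a b" "y = (\<Sum>(a, b)\<leftarrow>ps. pure a b)" by auto
    then show ?case by (intro exI[of _ "(sA c a, b) # ps"]) (simp add: pure_eqs)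
  qed
qed

end

section \<open>Sums in Sweedler notation\<close>

context self_dual_tensor_algebra
begin

lemma comult_exists:
  "\<exists>D. Vector_Spaces.linear sT sW D \<and> D 1 = pure 1 1 \<and>
     (\<forall>x a. D (\<iota> x * a) = (pure 1 (\<iota> x) + pure (\<iota> x) 1) * D a)"
proof (rule tensor_recursion)
  note pure_eqs = bilinear_mapD[OF pure_bilinear]
  show "linear_step sW (\<lambda>x a w. (pure 1 (\<iota> x) + pure (\<iota> x) 1) * w)"
    unfolding linear_step_def
    by (simp add: pure_eqs iota_add iota_scale W.vector_space_axioms W.scale_mult_left
        W.scale_mult_right W.scale_right_distrib algebra_simps)
qed

text \<open>
  The description of the comultiplication determines a unique map: recursion provides one, and a map
  that is multiplicative and known on the generators is unique.
\<close>

lemma comult_characterization: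
  "Vector_Spaces.linear sT sW comult \<and> comult 1 = pure 1 1 \<and>
   (\<forall>a b. comult (a * b) = comult a * comult b) \<and>
   (\<forall>x. comult (\<iota> x) = pure 1 (\<iota> x) + pure (\<iota> x) 1)"
proof -
  obtain D where D: "Vector_Spaces.linear sT sW D" "D 1 = pure 1 1"
    "\<And>x a. D (\<iota> x * a) = (pure 1 (\<iota> x) + pure (\<iota> x) 1) * D a"
    using comult_exists by blast
  interpret D: Vector_Spaces.linear sT sW D by (rule D)
  have D_mult: "D (a * b) = D a * D b" for a b
    by (induction a rule: tensor_algebra_induct)
       (simp_all add: D(2,3) pure_one mult.assoc distrib_right D.add D.scale
         T.scale_mult_left W.scale_mult_left)
  have D_iota: "D (\<iota> x) = pure 1 (\<iota> x) + pure (\<iota> x) 1" for x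
    using D(3)[of x 1] by (simp add: D(2) pure_one)
  have "comult = D"
    unfolding comult_def
  proof (rule the_equality)
    show "Vector_Spaces.linear sT sW D \<and> D 1 = pure 1 1 \<and>
        (\<forall>a b. D (a * b) = D a * D b) \<and> (\<forall>x. D (\<iota> x) = pure 1 (\<iota> x) + pure (\<iota> x) 1)"
      using D(1,2) D_mult D_iota by blast
  next
    fix E
    assume E: "Vector_Spaces.linear sT sW E \<and> E 1 = pure 1 1 \<and>
        (\<forall>a b. E (a * b) = E a * E b) \<and> (\<forall>x. E (\<iota> x) = pure 1 (\<iota> x) + pure (\<iota> x) 1)"
    then interpret E: Vector_Spaces.linear sT sW E by blast
    have "E a = D a" for a
      by (induction a rule: tensor_algebra_induct)
         (use E in \<open>simp_all add: D(2) D_mult D_iota D.add D.scale E.add E.scale\<close>)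
    then show "E = D" by blast
  qed
  with D(1,2) D_mult D_iota show ?thesis by simp
qed

lemma comult_step: "comult (\<iota> x * a) = (pure 1 (\<iota> x) + pure (\<iota> x) 1) * comult a"
  using comult_characterization by simp

lemma comult_sweedler: "comult a = (\<Sum>(p, q)\<leftarrow>sweedler a. pure p q)"
  unfolding sweedler_def by (rule someI_ex) (rule pure_decomposition)

definition sweedler_sum :: "('t \<Rightarrow> 't \<Rightarrow> 'v::ab_group_add) \<Rightarrow> 't \<Rightarrow> 'v" where
  "sweedler_sum F a = (\<Sum>(p, q)\<leftarrow>sweedler a. F p q)"

lemma linear_sum_list:
  assumes "Vector_Spaces.linear s s' h"
  shows "h (\<Sum>(p, q)\<leftarrow>ps. F p q) = (\<Sum>(p, q)\<leftarrow>ps. h (F p q))"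
proof -
  interpret h: Vector_Spaces.linear s s' h by fact
  show ?thesis by (induction ps) (auto simp: h.zero h.add)
qed

lemma sweedler_sum_linear_image:
  assumes "Vector_Spaces.linear s s' h"
  shows "h (sweedler_sum F a) = sweedler_sum (\<lambda>p q. h (F p q)) a"
  unfolding sweedler_sum_def by (rule linear_sum_list) fact

lemma sweedler_sum_plus:
  "sweedler_sum (\<lambda>p q. F p q + G p q) a = sweedler_sum F a + sweedler_sum G a"
proof -
  have "(\<Sum>(p, q)\<leftarrow>ps. F p q + G p q) = (\<Sum>(p, q)\<leftarrow>ps. F p q) + (\<Sum>(p, q)\<leftarrow>ps. G p q)" for ps
    by (induction ps) (auto simp: algebra_simps)
  then show ?thesis by (simp add: sweedler_sum_def)
qed

lemma sweedler_sum_scale: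
  assumes "vector_space s"
  shows "sweedler_sum (\<lambda>p q. s c (F p q)) a = s c (sweedler_sum F a)"
proof -
  interpret vector_space s by fact
  have "(\<Sum>(p, q)\<leftarrow>ps. s c (F p q)) = s c (\<Sum>(p, q)\<leftarrow>ps. F p q)" for ps
    by (induction ps) (auto simp: scale_right_distrib)
  then show ?thesis by (simp add: sweedler_sum_def)
qed

text \<open>
  A bilinear \<open>F\<close> factors through a linear map on the tensor square, so its Sweedler sum depends only
  on the comultiplication. The four rules compute it by recursion on \<open>a\<close>, and they carry all later
  proofs about Sweedler sums.
\<close>

lemma sweedler_sum_eqs:
  assumes "bilinear_map sT s F"
  shows sweedler_sum_add: "sweedler_sum F (a + b) = sweedler_sum F a + sweedler_sum F b"
    and sweedler_sum_scaled: "sweedler_sum F (sT c a) = s c (sweedler_sum F a)"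
    and sweedler_sum_one: "sweedler_sum F 1 = F 1 1"
    and sweedler_sum_step:
      "sweedler_sum F (\<iota> x * a) = sweedler_sum (\<lambda>p q. F (\<iota> x * p) q + F p (\<iota> x * q)) a"
proof -
  obtain h where h: "Vector_Spaces.linear sW s h" "\<And>a b. h (pure a b) = F a b"
    using bilinear_extend[OF assms] by blast
  interpret h: Vector_Spaces.linear sW s h by (rule h)
  interpret D: Vector_Spaces.linear sT sW comult using comult_characterization by blast
  have factor: "sweedler_sum F a = h (comult a)" for a
    by (simp add: comult_sweedler linear_sum_list[OF h(1)] h(2) sweedler_sum_def)
  show "sweedler_sum F (a + b) = sweedler_sum F a + sweedler_sum F b"
    "sweedler_sum F (sT c a) = s c (sweedler_sum F a)"
    by (simp_all add: factor D.add D.scale h.add h.scale)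
  show "sweedler_sum F 1 = F 1 1"
    using comult_characterization by (simp add: factor h(2))
  have distr: "(pure 1 (\<iota> x) + pure (\<iota> x) 1) * (\<Sum>(p, q)\<leftarrow>ps. pure p q) =
      (\<Sum>(p, q)\<leftarrow>ps. pure (\<iota> x * p) q + pure p (\<iota> x * q))" for ps
    by (induction ps) (auto simp: distrib_left distrib_right pure_mult add_ac)
  show "sweedler_sum F (\<iota> x * a) =
      sweedler_sum (\<lambda>p q. F (\<iota> x * p) q + F p (\<iota> x * q)) a"
    unfolding factor comult_step comult_sweedler[of a] distr linear_sum_list[OF h(1)]
    by (simp add: h.add h(2) sweedler_sum_def)
qed

lemma bilinear_step:
  assumes "bilinear_map sT s F"
  shows "bilinear_map sT s (\<lambda>p q. F (\<iota> x * p) q + F p (\<iota> x * q))"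
proof -
  note F = bilinear_mapD[OF assms]
  interpret V: vector_space s by (rule F)
  show ?thesis
    by (simp add: bilinear_map_def F distrib_left T.scale_mult_right V.scale_right_distrib
        V.vector_space_axioms add_ac)
qed

lemma sweedler_sum_iota:
  assumes "bilinear_map sT s F"
  shows "sweedler_sum F (\<iota> x) = F (\<iota> x) 1 + F 1 (\<iota> x)"
  using sweedler_sum_step[OF assms, of x 1] sweedler_sum_one[OF bilinear_step[OF assms]]
  by simp

section \<open>Contraction with a vector\<close>

lemma form_eqs:
  "form (x + y) z = form x z + form y z" "form x (y + z) = form x y + form x z"
  "form (sU c x) z = c * form x z" "form x (sU c z) = c * form x z"
  "form x y = form y x"
proof -
  have lin: "Vector_Spaces.linear sU (*) (form x)" for x
    using form by (simp add: symmetric_bilinear_form_def)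
  show sym: "form x y = form y x" for x y
    using form by (simp add: symmetric_bilinear_form_def)
  show add: "form x (y + z) = form x y + form x z" for x y z
  proof -
    interpret Vector_Spaces.linear sU "(*)" "form x" by (rule lin)
    show ?thesis by (rule add)
  qed
  show scale: "form x (sU c z) = c * form x z" for c x z
  proof -
    interpret Vector_Spaces.linear sU "(*)" "form x" by (rule lin)
    show ?thesis by (rule scale)
  qed
  show "form (x + y) z = form x z + form y z" "form (sU c x) z = c * form x z"
    using sym add scale by metis+
qed

definition contract :: "'u \<Rightarrow> 't \<Rightarrow> 't" where
  "contract x = tensor_rec sT 0 (\<lambda>y a d. sT (form x y) a + \<iota> y * d)"

lemma contract_linear: "Vector_Spaces.linear sT sT (contract x)"
  and contract_one: "contract x 1 = 0"
  and contract_step: "contract x (\<iota> y * a) = sT (form x y) a + \<iota> y * contract x a"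
proof -
  have "linear_step sT (\<lambda>y a d. sT (form x y) a + \<iota> y * d)"
    unfolding linear_step_def
    by (simp add: form_eqs(2,4) iota_add iota_scale T.vector_space_axioms T.scale_mult_left
        T.scale_mult_right T.scale_right_distrib T.scale_left_distrib algebra_simps)
  note tensor_rec[OF this, of 0, folded contract_def]
  then show "Vector_Spaces.linear sT sT (contract x)" "contract x 1 = 0"
    "contract x (\<iota> y * a) = sT (form x y) a + \<iota> y * contract x a" by blast+
qed

lemma contract_add: "contract x (a + b) = contract x a + contract x b"
  and contract_scale: "contract x (sT c a) = sT c (contract x a)"
  and contract_zero: "contract x 0 = 0"
proof -
  interpret Vector_Spaces.linear sT sT "contract x" by (rule contract_linear)
  show "contract x (a + b) = contract x a + contract x b"
    "contract x (sT c a) = sT c (contract x a)" "contract x 0 = 0"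
    by (rule add, rule scale, rule zero)
qed

lemma contract_vector_add: "contract (x + y) a = contract x a + contract y a"
  by (induction a rule: tensor_algebra_induct)
     (simp_all add: contract_one contract_step contract_add contract_scale form_eqs(1)
       T.scale_left_distrib T.scale_right_distrib algebra_simps)

lemma contract_vector_scale: "contract (sU c x) a = sT c (contract x a)"
  by (induction a rule: tensor_algebra_induct)
     (simp_all add: contract_one contract_step contract_add contract_scale form_eqs(3)
       T.scale_right_distrib T.scale_mult_right mult.commute)

lemma contract_product: "contract x (a * b) = contract x a * b + a * contract x b"
  by (induction a rule: tensor_algebra_induct)
     (simp_all add: contract_one contract_step contract_add contract_scale mult.assoc
       T.scale_right_distrib T.scale_mult_left algebra_simps)

text \<open>
  On \<open>\<iota> z * a\<close> the terms in which \<open>x\<close> or \<open>y\<close> is paired with \<open>z\<close> are the same on both sides, which is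
  why induction on \<open>a\<close> suffices.
\<close>

lemma contract_commute: "contract x (contract y a) = contract y (contract x a)"
  by (induction a rule: tensor_algebra_induct)
     (simp_all add: contract_one contract_zero contract_step contract_add contract_scale)

text \<open>
  Contracting commutes with comultiplication, on either tensor factor. The first form amounts to
  coassociativity and the second to cocommutativity in addition. Both sides satisfy the same
  recursion, since pairing \<open>x\<close> with a factor of \<open>b\<close> removes it regardless of the side it is on.
\<close>

lemma sweedler_sum_contract:
  assumes "bilinear_map sT s F"
  shows sweedler_sum_contract_left:
      "sweedler_sum F (contract x b) = sweedler_sum (\<lambda>p q. F (contract x p) q) b"
    and sweedler_sum_contract_right:
      "sweedler_sum F (contract x b) = sweedler_sum (\<lambda>p q. F p (contract x q)) b"
proof -
  have contracted: "bilinear_map sT s (\<lambda>p q. F (contract x p) q)"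
      "bilinear_map sT s (\<lambda>p q. F p (contract x q))"
    if "bilinear_map sT s F" for F
    using bilinear_mapD[OF that] by (simp_all add: bilinear_map_def contract_add contract_scale)
  have zero: "sweedler_sum F 0 = 0" "F 0 a = 0" "F a 0 = 0" if "bilinear_map sT s F" for F a
    using sweedler_sum_add[OF that, of 0 0] bilinear_mapD(2)[OF that, of 0 0]
      bilinear_mapD(4)[OF that, of _ 0 0] by simp_all
  have V: "vector_space s" by (rule bilinear_mapD[OF assms])
  show "sweedler_sum F (contract x b) = sweedler_sum (\<lambda>p q. F (contract x p) q) b"
    using assms
  proof (induction b arbitrary: F rule: tensor_algebra_induct)
    case one
    then show ?case by (simp add: contract_one sweedler_sum_one[OF contracted(1)] zero)
  next
    case (mult y b)
    note F = bilinear_mapD[OF mult.prems]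
    have "sweedler_sum F (contract x (\<iota> y * b)) = s (form x y) (sweedler_sum F b) +
        sweedler_sum (\<lambda>p q. F (\<iota> y * contract x p) q + F (contract x p) (\<iota> y * q)) b"
      by (simp add: contract_step sweedler_sum_eqs[OF mult.prems]
          mult.IH[OF bilinear_step[OF mult.prems]])
    also have "\<dots> = sweedler_sum (\<lambda>p q. s (form x y) (F p q) +
        (F (\<iota> y * contract x p) q + F (contract x p) (\<iota> y * q))) b"
      by (simp add: sweedler_sum_plus sweedler_sum_scale[OF V])
    also have "\<dots> = sweedler_sum (\<lambda>p q. F (contract x p) q) (\<iota> y * b)"
      by (simp add: sweedler_sum_step[OF contracted(1)[OF mult.prems]] contract_step F add.assoc)
    finally show ?case .
  next
    case (add a b)
    then show ?case
      by (simp add: contract_add sweedler_sum_add[OF add.prems]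
          sweedler_sum_add[OF contracted(1)[OF add.prems]])
  next
    case (scale c a)
    then show ?case
      by (simp add: contract_scale sweedler_sum_scaled[OF scale.prems]
          sweedler_sum_scaled[OF contracted(1)[OF scale.prems]])
  qed
  show "sweedler_sum F (contract x b) = sweedler_sum (\<lambda>p q. F p (contract x q)) b"
    using assms
  proof (induction b arbitrary: F rule: tensor_algebra_induct)
    case one
    then show ?case by (simp add: contract_one sweedler_sum_one[OF contracted(2)] zero)
  next
    case (mult y b)
    note F = bilinear_mapD[OF mult.prems]
    have "sweedler_sum F (contract x (\<iota> y * b)) = s (form x y) (sweedler_sum F b) +
        sweedler_sum (\<lambda>p q. F (\<iota> y * p) (contract x q) + F p (\<iota> y * contract x q)) b"
      by (simp add: contract_step sweedler_sum_eqs[OF mult.prems]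
          mult.IH[OF bilinear_step[OF mult.prems]])
    also have "\<dots> = sweedler_sum (\<lambda>p q. s (form x y) (F p q) +
        (F (\<iota> y * p) (contract x q) + F p (\<iota> y * contract x q))) b"
      by (simp add: sweedler_sum_plus sweedler_sum_scale[OF V])
    also have "\<dots> = sweedler_sum (\<lambda>p q. F p (contract x q)) (\<iota> y * b)"
      by (simp add: sweedler_sum_step[OF contracted(2)[OF mult.prems]] contract_step F add_ac)
    finally show ?case .
  next
    case (add a b)
    then show ?case
      by (simp add: contract_add sweedler_sum_add[OF add.prems]
          sweedler_sum_add[OF contracted(2)[OF add.prems]])
  next
    case (scale c a)
    then show ?case
      by (simp add: contract_scale sweedler_sum_scaled[OF scale.prems]
          sweedler_sum_scaled[OF contracted(2)[OF scale.prems]])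
  qed
qed

section \<open>The Laplace pairing\<close>

definition counit :: "'t \<Rightarrow> 'k" where
  "counit = tensor_rec (*) 1 (\<lambda>x a v. 0)"

lemma counit_linear: "Vector_Spaces.linear sT (*) counit"
  and counit_one: "counit 1 = 1"
  and counit_step: "counit (\<iota> x * a) = 0"
proof -
  have "linear_step (*) (\<lambda>x a v. 0 :: 'k)"
    by (simp add: linear_step_def vector_space_field)
  note tensor_rec[OF this, of 1, folded counit_def]
  then show "Vector_Spaces.linear sT (*) counit" "counit 1 = 1" "counit (\<iota> x * a) = 0" by blast+
qed

lemma counit_add: "counit (a + b) = counit a + counit b"
  and counit_scale: "counit (sT c a) = c * counit a"
proof -
  interpret Vector_Spaces.linear sT "(*)" counit by (rule counit_linear)
  show "counit (a + b) = counit a + counit b" "counit (sT c a) = c * counit a"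
    by (rule add, rule scale)
qed

lemma counit_iota: "counit (\<iota> x) = 0"
  using counit_step[of x 1] by simp

lemma counit_mult: "counit (a * b) = counit a * counit b"
  by (induction a rule: tensor_algebra_induct)
     (simp_all add: counit_one counit_step counit_add counit_scale mult.assoc distrib_right
       T.scale_mult_left)

text \<open>
  The extension of \<open>contract\<close> from vectors to an action of the whole algebra. Products of
  contractions stand in the order of the factors of \<open>a\<close>, which is immaterial as they commute.
\<close>

definition contract_all :: "'t \<Rightarrow> 't \<Rightarrow> 't" where
  "contract_all a b = tensor_rec sT b (\<lambda>x _ d. contract x d) a"

lemma contract_all_eqs:
  shows contract_all_one: "contract_all 1 b = b"
    and contract_all_step: "contract_all (\<iota> x * a) b = contract x (contract_all a b)"
    and contract_all_add: "contract_all (a + a') b = contract_all a b + contract_all a' b"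
    and contract_all_scale: "contract_all (sT c a) b = sT c (contract_all a b)"
proof -
  have step: "linear_step sT (\<lambda>x _ d. contract x d)"
    by (simp add: linear_step_def T.vector_space_axioms contract_add contract_scale
        contract_vector_add contract_vector_scale)
  interpret Vector_Spaces.linear sT sT "\<lambda>a. contract_all a b"
    unfolding contract_all_def by (rule tensor_rec(1)[OF step])
  show "contract_all 1 b = b" "contract_all (\<iota> x * a) b = contract x (contract_all a b)"
    using tensor_rec(2,3)[OF step] by (simp_all add: contract_all_def)
  show "contract_all (a + a') b = contract_all a b + contract_all a' b"
    "contract_all (sT c a) b = sT c (contract_all a b)"
    by (rule add, rule scale)
qed

lemma contract_all_add_right: "contract_all a (b + b') = contract_all a b + contract_all a b'"
  by (induction a rule: tensor_algebra_induct)
     (simp_all add: contract_all_eqs contract_add T.scale_right_distrib)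

lemma contract_all_scale_right: "contract_all a (sT c b) = sT c (contract_all a b)"
  by (induction a rule: tensor_algebra_induct)
     (simp_all add: contract_all_eqs contract_scale T.scale_right_distrib mult.commute)

lemma contract_all_unit: "contract_all a 1 = sT (counit a) 1"
  by (induction a rule: tensor_algebra_induct)
     (simp_all add: contract_all_eqs counit_one counit_step counit_add counit_scale
       contract_scale contract_one T.scale_left_distrib)

lemma contract_all_contract: "contract_all a (contract x b) = contract x (contract_all a b)"
  by (induction a rule: tensor_algebra_induct)
     (simp_all add: contract_all_eqs contract_add contract_scale contract_commute[of x])

text \<open>
  Either \<open>x\<close> survives the action of \<open>c\<close>, or exactly one factor of \<open>c\<close> is paired with it. This turns
  multiplication by \<open>\<iota> x\<close> in the second argument of the pairing into contraction of the first one,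
  and it is the step that uses the symmetry of the form.
\<close>

lemma contract_all_vector_product:
  "contract_all c (\<iota> x * b) = \<iota> x * contract_all c b + contract_all (contract x c) b"
proof (induction c rule: tensor_algebra_induct)
  case one
  have "contract_all 0 b = 0" using contract_all_scale[of 0 0 b] by simp
  then show ?case by (simp add: contract_all_one contract_one)
next
  case (mult y c)
  then show ?case
    by (simp add: contract_all_eqs contract_step contract_add form_eqs(5)[of x y])
qed (simp_all add: contract_all_eqs contract_add contract_scale T.scale_right_distrib
      T.scale_mult_right distrib_left)

lemma contract_all_product_bilinear:
  "bilinear_map sT sT (\<lambda>p q. contract_all p b * contract_all q c)"
  by (simp add: bilinear_map_def contract_all_eqs distrib_left distrib_right
      T.vector_space_axioms T.scale_mult_left T.scale_mult_right)

text \<open>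
  The Leibniz rule for products of derivations: each factor of \<open>a\<close> contracts either \<open>b\<close> or \<open>c\<close>, and
  the comultiplication of \<open>a\<close> lists these distributions.
\<close>

lemma contract_all_product:
  "contract_all a (b * c) = sweedler_sum (\<lambda>p q. contract_all p b * contract_all q c) a"
proof (induction a rule: tensor_algebra_induct)
  case one
  show ?case by (simp add: sweedler_sum_one[OF contract_all_product_bilinear] contract_all_one)
next
  case (mult x a)
  then show ?case
    by (simp add: sweedler_sum_step[OF contract_all_product_bilinear] contract_all_step
        sweedler_sum_linear_image[OF contract_linear] contract_product)
qed (simp_all add: contract_all_eqs sweedler_sum_eqs[OF contract_all_product_bilinear])

definition pairing :: "'t \<Rightarrow> 't \<Rightarrow> 'k" where
  "pairing a b = counit (contract_all a b)"

lemma pairing_bilinear: "bilinear_map sT (*) pairing"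
  by (simp add: bilinear_map_def vector_space_field pairing_def
      contract_all_eqs contract_all_add_right contract_all_scale_right counit_add counit_scale)

lemma pairing_one: "pairing 1 b = counit b"
  by (simp add: pairing_def contract_all_one)

lemma pairing_step: "pairing (\<iota> x * a) b = pairing a (contract x b)"
  by (simp add: pairing_def contract_all_step contract_all_contract)

text \<open>
  Multiplication by \<open>\<iota> x\<close> and contraction with \<open>x\<close> are adjoint on both sides: on the left by the
  commutation of contractions, on the right because the counit kills everything in which \<open>x\<close> is
  left over.
\<close>

lemma pairing_sym: "pairing a b = pairing b a"
proof (induction a arbitrary: b rule: tensor_algebra_induct)
  case one
  show ?case
    by (simp add: pairing_def contract_all_one contract_all_unit counit_scale counit_one)
next
  case (mult x a)
  have "pairing b (\<iota> x * a) = pairing (contract x b) a"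
    by (simp add: pairing_def contract_all_vector_product counit_add counit_step)
  then show ?case by (simp add: pairing_step mult)
qed (simp_all add: bilinear_mapD[OF pairing_bilinear])

definition is_laplace_pairing :: "('t \<Rightarrow> 't \<Rightarrow> 'k) \<Rightarrow> bool" where
  "is_laplace_pairing P \<longleftrightarrow> symmetric_bilinear_form sT P \<and>
     (\<forall>a b c. P a (b * c) = sweedler_sum (\<lambda>p q. P p b * P q c) a) \<and>
     P 1 1 = 1 \<and> (\<forall>x. P (\<iota> x) 1 = 0 \<and> P 1 (\<iota> x) = 0) \<and>
     (\<forall>x y. P (\<iota> x) (\<iota> y) = form x y)"

lemma pairing_is_laplace: "is_laplace_pairing pairing"
proof -
  note eqs = bilinear_mapD[OF pairing_bilinear]
  have V: "vector_space ((*) :: 'k \<Rightarrow> 'k \<Rightarrow> 'k)"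
    by (rule vector_space_field)
  have "symmetric_bilinear_form sT pairing"
    unfolding symmetric_bilinear_form_def
    by (auto intro!: linear_by_equations T.vector_space_axioms V simp: eqs pairing_sym)
  moreover have "pairing a (b * c) = sweedler_sum (\<lambda>p q. pairing p b * pairing q c) a" for a b c
    by (simp add: pairing_def contract_all_product sweedler_sum_linear_image[OF counit_linear]
        counit_mult)
  moreover have "pairing 1 1 = 1" by (simp add: pairing_one counit_one)
  moreover have "pairing 1 (\<iota> x) = 0" for x
    by (simp add: pairing_one counit_iota)
  moreover have "pairing (\<iota> x) (\<iota> y) = form x y" for x y
    using pairing_step[of x 1 "\<iota> y"] contract_step[of x y 1]
    by (simp add: pairing_one counit_scale counit_one contract_one)
  ultimately show ?thesis
    by (auto simp: is_laplace_pairing_def pairing_sym[of "\<iota> _" 1])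
qed

lemma is_laplace_pairingD:
  assumes "is_laplace_pairing P"
  shows "bilinear_map sT (*) P"
    and "P a b = P b a"
    and "P 1 a = counit a"
    and "P (\<iota> x) (\<iota> y * a) = form x y * counit a"
    and "P a (b * c) = sweedler_sum (\<lambda>p q. P p b * P q c) a"
proof -
  have sbf: "symmetric_bilinear_form sT P"
    and laplace: "P a (b * c) = sweedler_sum (\<lambda>p q. P p b * P q c) a"
    and vals: "P 1 1 = 1" "P 1 (\<iota> x) = 0" "P (\<iota> x) (\<iota> y) = form x y" for a b c x y
    using assms by (auto simp: is_laplace_pairing_def)
  show "P a (b * c) = sweedler_sum (\<lambda>p q. P p b * P q c) a" by (rule laplace)
  show sym: "P a b = P b a" for a b
    using sbf by (simp add: symmetric_bilinear_form_def)
  have right: "P a (b + b') = P a b + P a b'" "P a (sT c b) = c * P a b" for a b b' c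
  proof -
    interpret Vector_Spaces.linear sT "(*)" "P a"
      using sbf by (simp add: symmetric_bilinear_form_def)
    show "P a (b + b') = P a b + P a b'" "P a (sT c b) = c * P a b" by (rule add, rule scale)
  qed
  have left: "P (a + a') b = P a b + P a' b" "P (sT c a) b = c * P a b" for a a' b c
    by (simp_all add: sym[of _ b] right)
  show bil: "bilinear_map sT (*) P"
    using right left by (simp add: bilinear_map_def vector_space_field)
  have prod_bil: "bilinear_map sT (*) (\<lambda>p q. P p b * P q c)" for b c
    by (simp add: bilinear_map_def vector_space_field
        bilinear_mapD[OF bil] algebra_simps)
  show unit: "P 1 a = counit a" for a
    by (induction a rule: tensor_algebra_induct)
       (simp_all add: vals laplace sweedler_sum_one[OF prod_bil] counit_one counit_step
         counit_add counit_scale right)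
  show "P (\<iota> x) (\<iota> y * a) = form x y * counit a"
    by (simp add: laplace sweedler_sum_iota[OF prod_bil] vals unit counit_iota)
qed

text \<open>
  The Laplace identity with \<open>b = \<iota> x\<close> reduces \<open>P a (\<iota> x * c)\<close> to values at \<open>c\<close> and to values
  \<open>P p (\<iota> x) = P (\<iota> x) p\<close>, and the latter are known explicitly.
\<close>

lemma is_laplace_pairing_unique:
  assumes "is_laplace_pairing P" "is_laplace_pairing Q"
  shows "P = Q"
proof -
  note P = is_laplace_pairingD[OF assms(1)] and Q = is_laplace_pairingD[OF assms(2)]
  have "P (\<iota> x) a = Q (\<iota> x) a" for x a
    by (induction a rule: tensor_algebra_induct)
       (simp_all add: P(4) Q(4) P(2)[of _ 1] Q(2)[of _ 1] P(3) Q(3) bilinear_mapD[OF P(1)]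
         bilinear_mapD[OF Q(1)])
  then have vec: "P a (\<iota> x) = Q a (\<iota> x)" for a x
    by (simp add: P(2)[of a] Q(2)[of a])
  have "P a b = Q a b" for a b
  proof (induction b arbitrary: a rule: tensor_algebra_induct)
    case one
    show ?case by (simp add: P(2)[of _ 1] Q(2)[of _ 1] P(3) Q(3))
  qed (simp_all add: P(5) Q(5) vec bilinear_mapD[OF P(1)] bilinear_mapD[OF Q(1)])
  then show ?thesis by blast
qed

lemma laplace_eq_pairing: "laplace = pairing"
proof -
  have "laplace = (THE P. is_laplace_pairing P)"
    by (simp add: laplace_def is_laplace_pairing_def sweedler_sum_def)
  also have "\<dots> = pairing"
    using pairing_is_laplace is_laplace_pairing_unique by (intro the_equality) blast+
  finally show ?thesis .
qed

section \<open>The square product\<close>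

lemma square_alt:
  "square a b = sweedler_sum (\<lambda>p q. sweedler_sum (\<lambda>r t. sT (pairing p r) (q * t)) b) a"
  by (simp add: square_def sweedler_sum_def laplace_eq_pairing)

lemma square_kernel_bilinear:
  "bilinear_map sT sT (\<lambda>r t. sT (pairing p r) (q * t))"
  by (simp add: bilinear_map_def T.vector_space_axioms bilinear_mapD[OF pairing_bilinear]
      T.scale_left_distrib T.scale_right_distrib distrib_left T.scale_mult_right mult.commute)

lemma square_summand_bilinear:
  "bilinear_map sT sT (\<lambda>p q. sweedler_sum (\<lambda>r t. sT (pairing p r) (q * t)) b)"
proof -
  have "sT (pairing (sT c p) r) (q * t) = sT c (sT (pairing p r) (q * t))"
    "sT (pairing p r) (sT c q * t) = sT c (sT (pairing p r) (q * t))" for c p q r t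
    by (simp_all add: bilinear_mapD[OF pairing_bilinear] T.scale_mult_left mult.commute)
  then show ?thesis
    by (simp only: bilinear_map_def T.vector_space_axioms bilinear_mapD(2)[OF pairing_bilinear]
        T.scale_left_distrib T.scale_right_distrib distrib_right sweedler_sum_plus
        sweedler_sum_scale[OF T.vector_space_axioms] simp_thms)
qed

lemma square_add_left: "square (a + a') b = square a b + square a' b"
  and square_scale_left: "square (sT c a) b = sT c (square a b)"
  by (simp_all add: square_alt sweedler_sum_eqs[OF square_summand_bilinear])

lemma mult_vector_linear: "Vector_Spaces.linear sT sT ((*) (\<iota> x))"
  by (rule linear_by_equations)
     (simp_all add: T.vector_space_axioms distrib_left T.scale_mult_right)

lemma square_one_left: "square 1 b = b"
proof -
  have bil: "bilinear_map sT sT (\<lambda>r t. sT (counit r) t)"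
    using square_kernel_bilinear[of 1 1] by (simp add: pairing_one)
  have "sweedler_sum (\<lambda>r t. sT (counit r) t) b = b"
  proof (induction b rule: tensor_algebra_induct)
    case one
    show ?case by (simp add: sweedler_sum_one[OF bil] counit_one)
  next
    case (mult x b)
    have "sweedler_sum (\<lambda>r t. sT (counit r) t) (\<iota> x * b) =
        sweedler_sum (\<lambda>r t. \<iota> x * sT (counit r) t) b"
      by (simp add: sweedler_sum_step[OF bil] counit_step T.scale_mult_right)
    also have "\<dots> = \<iota> x * b"
      using sweedler_sum_linear_image[OF mult_vector_linear, of x "\<lambda>r t. sT (counit r) t" b] mult
      by simp
    finally show ?case .
  qed (simp_all add: sweedler_sum_eqs[OF bil])
  then show ?thesis
    by (simp add: square_alt sweedler_sum_one[OF square_summand_bilinear] pairing_one)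
qed

text \<open>
  The factor \<open>x\<close> of the left argument goes either into the product, on the far left, or into the
  pairing, where it becomes a contraction of \<open>b\<close> by adjointness.
\<close>

lemma square_step: "square (\<iota> x * a) b = \<iota> x * square a b + square a (contract x b)"
  by (simp add: square_alt sweedler_sum_step[OF square_summand_bilinear] pairing_step
      sweedler_sum_contract_left[OF square_kernel_bilinear] sweedler_sum_plus mult.assoc
      sweedler_sum_linear_image[OF mult_vector_linear] T.scale_mult_right add.commute)

lemma square_vector: "square (\<iota> x) b = \<iota> x * b + contract x b"
  using square_step[of x 1 b] by (simp add: square_one_left)

text \<open>
  The contraction meets only the ordinary product of the second Sweedler components, where the
  Leibniz rule holds, and contracting a second component is the same as contracting the whole
  element (\<open>sweedler_sum_contract_right\<close>).
\<close>

lemma contract_square: "contract x (square a b) = square (contract x a) b + square a (contract x b)"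
  by (simp add: square_alt sweedler_sum_contract_right[OF square_summand_bilinear]
      sweedler_sum_contract_right[OF square_kernel_bilinear] contract_product contract_scale
      sweedler_sum_linear_image[OF contract_linear] T.scale_right_distrib sweedler_sum_plus)

text \<open>
  Both sides equal \<open>\<iota> x * (a \<box> b) + D x a \<box> b + a \<box> D x b\<close>, where \<open>D x\<close> is contraction with \<open>x\<close>.
\<close>

lemma square_assoc_vector: "square (\<iota> x) (square a b) = square (square (\<iota> x) a) b"
  by (simp add: square_vector square_step square_add_left contract_square)

section \<open>The isomorphism\<close>

text \<open>
  On \<open>x1 \<otimes> \<dots> \<otimes> xn\<close> this is the sum over all partial matchings of the factors, with weight \<open>c\<close> times
  the value of the form for each matched pair, of the product of the unmatched factors (Wick's
  formula); informally it is the exponential of \<open>c\<close> times the contraction of pairs. The inverse is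
  therefore expected at \<open>- c\<close>.
\<close>

definition wick :: "'k \<Rightarrow> 't \<Rightarrow> 't" where
  "wick c = tensor_rec sT 1 (\<lambda>x _ v. \<iota> x * v + sT c (contract x v))"

lemma wick_linear: "Vector_Spaces.linear sT sT (wick c)"
  and wick_one: "wick c 1 = 1"
  and wick_step: "wick c (\<iota> x * a) = \<iota> x * wick c a + sT c (contract x (wick c a))"
proof -
  have "linear_step sT (\<lambda>x _ v. \<iota> x * v + sT c (contract x v))"
    unfolding linear_step_def
    by (simp add: T.vector_space_axioms iota_add iota_scale T.scale_mult_left T.scale_mult_right
        T.scale_right_distrib contract_add contract_scale contract_vector_add
        contract_vector_scale algebra_simps)
  note tensor_rec[OF this, of 1, folded wick_def]
  then show "Vector_Spaces.linear sT sT (wick c)" "wick c 1 = 1"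
    "wick c (\<iota> x * a) = \<iota> x * wick c a + sT c (contract x (wick c a))" by blast+
qed

lemma wick_add: "wick c (a + b) = wick c a + wick c b"
  and wick_scale: "wick c (sT d a) = sT d (wick c a)"
  and wick_zero: "wick c 0 = 0"
proof -
  interpret Vector_Spaces.linear sT sT "wick c" by (rule wick_linear)
  show "wick c (a + b) = wick c a + wick c b" "wick c (sT d a) = sT d (wick c a)" "wick c 0 = 0"
    by (rule add, rule scale, rule zero)
qed

lemma wick_contract: "wick c (contract x a) = contract x (wick c a)"
proof (induction a rule: tensor_algebra_induct)
  case (mult y a)
  then show ?case
    by (simp add: contract_step wick_step wick_add wick_scale contract_add contract_scale
        contract_commute[of y x])
qed (simp_all add: contract_one wick_one wick_zero contract_add contract_scale wick_add wick_scale)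

text \<open>
  Applied to \<open>\<iota> x * wick c a\<close> and to \<open>c\<close> times the contraction of \<open>wick c a\<close>, \<open>wick (- c)\<close> gives
  contraction terms that cancel, because it commutes with contraction.
\<close>

lemma wick_inverse: "wick (- c) (wick c a) = a"
proof (induction a rule: tensor_algebra_induct)
  case (mult x a)
  then show ?case
    by (simp add: wick_step wick_add wick_scale wick_contract)
qed (simp_all add: wick_one wick_add wick_scale)

lemma wick_one_bij: "bij (wick 1)"
proof (rule o_bij)
  show "wick (- 1) \<circ> wick 1 = id" using wick_inverse[of 1] by auto
  show "wick 1 \<circ> wick (- 1) = id" using wick_inverse[of "- 1"] by auto
qed

lemma wick_one_square: "wick 1 (\<iota> x * a) = square (\<iota> x) (wick 1 a)"
  by (simp add: wick_step square_vector)

lemma wick_one_tensor: "wick 1 (tensor (x # xs)) = iterate_prod square (\<iota> x) (map \<iota> xs)"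
proof (induction xs arbitrary: x)
  case Nil
  show ?case using wick_step[of 1 x 1] by (simp add: wick_one contract_one)
next
  case (Cons y xs)
  then show ?case by (simp add: wick_one_square)
qed

lemma phi_eq_wick: "phi = wick 1"
  unfolding phi_def
proof (rule the_equality)
  show "Vector_Spaces.linear sT sT (wick 1) \<and> wick 1 1 = 1 \<and>
      (\<forall>x xs. wick 1 (tensor (x # xs)) = iterate_prod square (\<iota> x) (map \<iota> xs))"
    using wick_linear wick_one wick_one_tensor by blast
next
  fix f
  assume f: "Vector_Spaces.linear sT sT f \<and> f 1 = 1 \<and>
      (\<forall>x xs. f (tensor (x # xs)) = iterate_prod square (\<iota> x) (map \<iota> xs))"
  then interpret f: Vector_Spaces.linear sT sT f by blast
  interpret w: Vector_Spaces.linear sT sT "wick 1" by (rule wick_linear)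
  interpret TT: vector_space_pair sT sT ..
  have eq: "f (tensor xs) = wick 1 (tensor xs)" for xs
  proof (cases xs)
    case Nil
    then show ?thesis using f by (simp add: wick_one)
  next
    case (Cons x ys)
    then show ?thesis using f wick_one_tensor by metis
  qed
  have "f a = wick 1 a" for a
  proof -
    have "a \<in> T.span (range tensor)" by (simp add: span_tensor)
    then show ?thesis
      by (induction rule: T.span_induct_alt) (auto simp: f.zero f.add f.scale w.zero w.add w.scale eq)
  qed
  then show "f = wick 1" by blast
qed

lemma phi_mult: "phi (u * v) = square (phi u) (phi v)"
proof (induction u rule: tensor_algebra_induct)
  case (mult x u)
  then show ?case
    by (simp add: phi_eq_wick mult.assoc wick_one_square square_assoc_vector)
qed (simp_all add: phi_eq_wick wick_one square_one_left wick_add wick_scale square_add_left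
      square_scale_left distrib_right T.scale_mult_left)

end

theorem lemma4p2:
  fixes sU :: "'k::field \<Rightarrow> 'u::ab_group_add \<Rightarrow> 'u"
    and sT :: "'k \<Rightarrow> 't::ring_1 \<Rightarrow> 't"
    and \<iota> :: "'u \<Rightarrow> 't"
    and sW :: "'k \<Rightarrow> 'w::ring_1 \<Rightarrow> 'w"
    and pure :: "'t \<Rightarrow> 't \<Rightarrow> 'w"
    and form :: "'u \<Rightarrow> 'u \<Rightarrow> 'k"
  assumes "real_or_complex TYPE('k)"
    and "self_dual_tensor_algebra sU sT \<iota> sW pure form"
  shows "let square = self_dual_tensor_algebra.square sT \<iota> sW pure form;
             \<phi> = self_dual_tensor_algebra.phi sT \<iota> sW pure form
         in (\<forall>u v. \<phi> (u * v) = square (\<phi> u) (\<phi> v)) \<and> inj \<phi> \<and> surj \<phi>"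
proof -
  interpret self_dual_tensor_algebra sU sT \<iota> sW pure form by fact
  show ?thesis
    using phi_mult wick_one_bij by (simp add: phi_eq_wick bij_def)
qed

end
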